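(* Let $(\Gamma,\mathcal{G}_\Gamma)$ and $(\Sigma,\mathcal{G}_\Sigma)$ be labeled graphs whose vertex groups are all primary cyclic groups, and let $\tau:W(\Gamma)\to W(\Sigma)$ be a group isomorphism. Then there exists a labeled-graph isomorphism $t:(\Gamma,\mathcal{G}_\Gamma)\to(\Sigma,\mathcal{G}_\Sigma)$ such that $t(u)\in\mathrm{csupp}(\tau(u))$ for every $u\in V_\Gamma$.
   Context: A labeled graph $(\Lambda,\mathcal{G}_\Lambda)$ consists of a nonempty finite simplicial graph $\Lambda$ with vertex set $V_\Lambda$ and a family $\mathcal{G}_\Lambda=\{G_v\}_{v\in V_\Lambda}$ of nontrivial groups. Its graph product $W(\Lambda)$ is the quotient of the free product $\ast_{v}G_v$ by the relations $gh=hg$ for $g\in G_v$, $h\in G_{v'}$ with $v,v'$ adjacent. A labeled-graph isomorphism $(\Gamma,\mathcal{G}_\Gamma)\to(\Sigma,\mathcal{G}_\Sigma)$ is a bijection $f:V_\Gamma\to V_\Sigma$ with $u,v$ adjacent iff $f(u),f(v)$ adjacent, and $G_u\cong G_{f(u)}$ for all $u$. A cyclic group is primary if it has prime-power order. For cyclic vertex groups, a generator of each $G_v$ is fixed and also denoted $v$; a word in $V_\Lambda^{\pm1}$ is reduced if no shorter word represents the same element; $\mathrm{supp}(g)$ is the set of vertices $v$ such that $v$ or $v^{-1}$ appears in some reduced word representing $g$; and $\mathrm{csupp}(g):=\{v\in V_\Lambda:\ v\in\mathrm{supp}(wgw^{-1})\text{ for all }w\in W(\Lambda)\}$. *)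

theory Defs
  imports "HOL-Algebra.Group" "HOL-Computational_Algebra.Primes"
begin

text \<open>A labeled graph with cyclic vertex groups: vertex set V (type 'a), adjacency
  relation E, and for every vertex v the order n v of the cyclic vertex group G_v,
  which is generated by the fixed generator v.  Letters of words are pairs (v, True)
  for v and (v, False) for v^-1.\<close>

definition labeled_graph :: "'a set \<Rightarrow> ('a \<Rightarrow> 'a \<Rightarrow> bool) \<Rightarrow> ('a \<Rightarrow> nat) \<Rightarrow> bool" where
  "labeled_graph V E n \<longleftrightarrow> finite V \<and> V \<noteq> {} \<and>
     (\<forall>u v. E u v \<longrightarrow> u \<in> V \<and> v \<in> V) \<and>
     (\<forall>u v. E u v \<longrightarrow> E v u) \<and> (\<forall>v. \<not> E v v) \<and>
     (\<forall>v\<in>V. n v \<ge> 2)"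

definition primary_labels :: "'a set \<Rightarrow> ('a \<Rightarrow> nat) \<Rightarrow> bool" where
  "primary_labels V n \<longleftrightarrow> (\<forall>v\<in>V. \<exists>p k. prime p \<and> k \<ge> 1 \<and> n v = p ^ k)"

definition words :: "'a set \<Rightarrow> ('a \<times> bool) list set" where
  "words V = lists (V \<times> UNIV)"

inductive weq :: "'a set \<Rightarrow> ('a \<Rightarrow> 'a \<Rightarrow> bool) \<Rightarrow> ('a \<Rightarrow> nat)
    \<Rightarrow> ('a \<times> bool) list \<Rightarrow> ('a \<times> bool) list \<Rightarrow> bool"
  for V E n where
  refl: "w \<in> words V \<Longrightarrow> weq V E n w w"
| sym: "weq V E n a b \<Longrightarrow> weq V E n b a"
| trans: "weq V E n a b \<Longrightarrow> weq V E n b c \<Longrightarrow> weq V E n a c"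
| ctxt: "weq V E n a b \<Longrightarrow> x \<in> words V \<Longrightarrow> y \<in> words V \<Longrightarrow> weq V E n (x @ a @ y) (x @ b @ y)"
| cancel: "v \<in> V \<Longrightarrow> weq V E n [(v, b), (v, \<not> b)] []"
| power: "v \<in> V \<Longrightarrow> weq V E n (replicate (n v) (v, True)) []"
| comm: "E u v \<Longrightarrow> u \<in> V \<Longrightarrow> v \<in> V \<Longrightarrow> weq V E n [(u, b), (v, c)] [(v, c), (u, b)]"

definition wclass :: "'a set \<Rightarrow> ('a \<Rightarrow> 'a \<Rightarrow> bool) \<Rightarrow> ('a \<Rightarrow> nat)
    \<Rightarrow> ('a \<times> bool) list \<Rightarrow> ('a \<times> bool) list set" where
  "wclass V E n w = {w'. weq V E n w w'}"

definition graph_product :: "'a set \<Rightarrow> ('a \<Rightarrow> 'a \<Rightarrow> bool) \<Rightarrow> ('a \<Rightarrow> nat)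
    \<Rightarrow> ('a \<times> bool) list set monoid" where
  "graph_product V E n =
     \<lparr> carrier = wclass V E n ` words V,
       monoid.mult = (\<lambda>A B. {c. \<exists>a\<in>A. \<exists>b\<in>B. weq V E n (a @ b) c}),
       monoid.one = wclass V E n [] \<rparr>"

definition gen :: "'a set \<Rightarrow> ('a \<Rightarrow> 'a \<Rightarrow> bool) \<Rightarrow> ('a \<Rightarrow> nat) \<Rightarrow> 'a
    \<Rightarrow> ('a \<times> bool) list set" where
  "gen V E n v = wclass V E n [(v, True)]"

definition reduced :: "'a set \<Rightarrow> ('a \<Rightarrow> 'a \<Rightarrow> bool) \<Rightarrow> ('a \<Rightarrow> nat)
    \<Rightarrow> ('a \<times> bool) list \<Rightarrow> bool" where
  "reduced V E n w \<longleftrightarrow> w \<in> words V \<and> (\<forall>w'. weq V E n w w' \<longrightarrow> length w \<le> length w')"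

definition supp :: "'a set \<Rightarrow> ('a \<Rightarrow> 'a \<Rightarrow> bool) \<Rightarrow> ('a \<Rightarrow> nat)
    \<Rightarrow> ('a \<times> bool) list set \<Rightarrow> 'a set" where
  "supp V E n g = {v. \<exists>w. w \<in> g \<and> reduced V E n w \<and> v \<in> fst ` set w}"

definition csupp :: "'a set \<Rightarrow> ('a \<Rightarrow> 'a \<Rightarrow> bool) \<Rightarrow> ('a \<Rightarrow> nat)
    \<Rightarrow> ('a \<times> bool) list set \<Rightarrow> 'a set" where
  "csupp V E n g = {v \<in> V. \<forall>w\<in>carrier (graph_product V E n).
     v \<in> supp V E n (w \<otimes>\<^bsub>graph_product V E n\<^esub> g \<otimes>\<^bsub>graph_product V E n\<^esub>
                      inv\<^bsub>graph_product V E n\<^esub> w)}"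

definition labeled_graph_iso :: "'a set \<Rightarrow> ('a \<Rightarrow> 'a \<Rightarrow> bool) \<Rightarrow> ('a \<Rightarrow> nat)
    \<Rightarrow> 'b set \<Rightarrow> ('b \<Rightarrow> 'b \<Rightarrow> bool) \<Rightarrow> ('b \<Rightarrow> nat) \<Rightarrow> ('a \<Rightarrow> 'b) \<Rightarrow> bool" where
  "labeled_graph_iso V1 E1 n1 V2 E2 n2 t \<longleftrightarrow> bij_betw t V1 V2 \<and>
     (\<forall>u\<in>V1. \<forall>v\<in>V1. E1 u v \<longleftrightarrow> E2 (t u) (t v)) \<and>
     (\<forall>u\<in>V1. n1 u = n2 (t u))"

end

theory Submission
  imports Defs "HOL-Number_Theory.Cong" "Jordan_Normal_Form.Determinant"
    "HOL-Analysis.Complex_Transcendental"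
begin

text \<open>Everything is read off the abelianizations. If g has finite order and non-zero coordinates
  at two distinct vertices, these are adjacent: otherwise retract onto the free product of the two
  vertex groups, where such an element has infinite order. Hence, for adjacent u and v, the supports
  of the abelianized elements \<tau>(u) and \<tau>(v) span a clique, so \<^emph>\<open>any\<close> bijection t with t(u) in the
  support of \<tau>(u) maps edges to edges; comparing with the same construction for the inverse of \<tau>,
  the number of edges shows that t is a graph isomorphism. Such a bijection preserving the labels
  exists because, for each prime power q = p^k, the block of the matrix of \<tau> indexed by the vertices
  with label q is invertible modulo p, so some term of its determinant is non-zero. Coordinates in
  the abelianization are conjugation invariant, whence t(u) even lies in csupp(\<tau>(u)).\<close>

section \<open>Torsion in free products of two cyclic groups\<close>

text \<open>A pair (a, b) stands for the two syllables X^a Y^b. Natural exponents are enough because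
  the maps inserted for X and Y have finite order, and exponents giving trivial syllables are
  allowed so that arbitrary words can be encoded.\<close>

primrec alternating :: "('c \<Rightarrow> 'c) \<Rightarrow> ('c \<Rightarrow> 'c) \<Rightarrow> (nat \<times> nat) list \<Rightarrow> 'c \<Rightarrow> 'c" where
  "alternating X Y [] = id"
| "alternating X Y (p # ps) = (X ^^ fst p) \<circ> (Y ^^ snd p) \<circ> alternating X Y ps"

lemma alternating_append:
  "alternating X Y (ps @ qs) = alternating X Y ps \<circ> alternating X Y qs"
  by (induction ps) (auto simp: comp_assoc)

lemma alternating_concat_replicate:
  "alternating X Y (concat (replicate N ps)) = alternating X Y ps ^^ N"
  by (induction N) (auto simp: alternating_append)

lemma funpow_eq_id_of_dvd:
  assumes "f ^^ m = id" "m dvd a"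
  shows "f ^^ a = id"
proof -
  obtain c where "a = m * c" using assms(2) by auto
  then show ?thesis using assms(1) by (simp add: funpow_mult[symmetric])
qed

lemma bij_of_funpow_eq_id:
  assumes "f ^^ m = id" "m > 0"
  shows "bij f"
proof -
  obtain l where m: "m = Suc l" using assms(2) gr0_implies_Suc by blast
  have "f \<circ> f ^^ l = id" "f ^^ l \<circ> f = id"
    using assms(1) funpow.simps(2)[of l f] funpow_Suc_right[of l f] unfolding m by metis+
  then show ?thesis using o_bij by blast
qed

lemma bij_alternating:
  assumes "bij X" "bij Y"
  shows "bij (alternating X Y ps)"
  by (induction ps)
    (use assms in \<open>simp_all only: alternating.simps bij_id bij_comp bij_betw_funpow\<close>)

text \<open>Q intertwines the two compositions: (QP)^N Q = Q (PQ)^N. Surjectivity of Q then allows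
  cancelling it on the right.\<close>

lemma funpow_comp_swap_eq_id:
  assumes "(P \<circ> Q) ^^ N = id" "surj Q"
  shows "(Q \<circ> P) ^^ N = id"
proof -
  have "(Q \<circ> P) ^^ N \<circ> Q = Q \<circ> (P \<circ> Q) ^^ N"
  proof (induction N)
    case (Suc N)
    have "(Q \<circ> P) ^^ Suc N \<circ> Q = (Q \<circ> P) \<circ> ((Q \<circ> P) ^^ N \<circ> Q)"
      by (simp add: comp_assoc)
    also have "\<dots> = Q \<circ> (P \<circ> Q) ^^ Suc N" unfolding Suc by (simp add: comp_assoc)
    finally show ?case .
  qed simp
  then have "(Q \<circ> P) ^^ N \<circ> Q = Q" using assms(1) by simp
  then show ?thesis using assms(2) by (metis comp_id fun.map_id surj_fun_eq fun_eq_iff comp_apply surjD id_apply)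
qed

text \<open>A trivial syllable is removed by conjugating cyclically and merging its two neighbours, so
  that only powers of words without trivial syllables remain.\<close>

lemma alternating_infinite_order:
  fixes X Y :: "'c \<Rightarrow> 'c"
  assumes X: "X ^^ m = id" "m > 0" and Y: "Y ^^ k = id" "k > 0"
    and free: "\<And>ps. ps \<noteq> [] \<Longrightarrow> \<forall>(a, b) \<in> set ps. \<not> m dvd a \<and> \<not> k dvd b \<Longrightarrow> alternating X Y ps \<noteq> id"
    and "\<not> m dvd sum_list (map fst ps)" "\<not> k dvd sum_list (map snd ps)" "N > 0"
  shows "alternating X Y ps ^^ N \<noteq> id"
  using assms(6,7)
proof (induction ps rule: length_induct)
  case (1 ps)
  let ?A = "alternating X Y"
  \<comment> \<open>Cyclic rotation of a word preserves the property that its N-th power is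
    trivial.\<close>
  have rot: "?A (qs @ rs) ^^ N = id \<Longrightarrow> ?A (rs @ qs) ^^ N = id" for qs rs
    unfolding alternating_append
    by (rule funpow_comp_swap_eq_id)
      (auto intro!: bij_is_surj bij_alternating bij_of_funpow_eq_id[OF X] bij_of_funpow_eq_id[OF Y])
  have X0: "X ^^ a = id" if "m dvd a" for a using funpow_eq_id_of_dvd[OF X(1) that] .
  have Y0: "Y ^^ b = id" if "k dvd b" for b using funpow_eq_id_of_dvd[OF Y(1) that] .
  show ?case
  proof (cases "\<forall>(a, b) \<in> set ps. \<not> m dvd a \<and> \<not> k dvd b")
    case True
    have "ps \<noteq> []" using 1(2) by auto
    \<comment> \<open>Both exponents of every pair are non-trivial, so nothing merges at the seams
      of the N-fold concatenation, and \<open>free\<close> applies to it directly.\<close>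
    then have "concat (replicate N ps) \<noteq> []" using \<open>N > 0\<close> by (cases N) auto
    moreover have "set (concat (replicate N ps)) \<subseteq> set ps" by auto
    ultimately have "?A (concat (replicate N ps)) \<noteq> id" using True by (intro free) blast+
    then show ?thesis unfolding alternating_concat_replicate .
  next
    case False
    then obtain a b where ab: "(a, b) \<in> set ps" "m dvd a \<or> k dvd b" by auto
    then obtain us vs where ps: "ps = us @ (a, b) # vs" by (meson split_list)
    \<comment> \<open>If (a, b) were the only pair, the divisible exponent would be a whole exponent
      sum, against the hypotheses.\<close>
    have ne: "vs @ us \<noteq> []" using 1(2,3) ab(2) unfolding ps by auto
    show ?thesis
    proof
      assume eq: "?A ps ^^ N = id"
      from ab(2) show False
      proof
        \<comment> \<open>Rotate (a, b) to the end: X^a vanishes, so Y^b merges with the Y-power of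
          the pair before it. The word gets shorter, and the exponent sums change at most by the
          multiple a of m.\<close>
        assume a: "m dvd a"
        obtain ws c d where ws: "vs @ us = ws @ [(c, d)]"
          using ne by (metis rev_exhaust surj_pair)
        have "?A (vs @ us @ [(a, b)]) ^^ N = id"
          using rot[of "us @ [(a, b)]" vs] eq unfolding ps by simp
        moreover have "vs @ us @ [(a, b)] = ws @ [(c, d), (a, b)]" using ws by simp
        moreover have "?A (ws @ [(c, d), (a, b)]) = ?A (ws @ [(c, d + b)])"
          by (simp add: alternating_append X0[OF a] funpow_add comp_assoc)
        ultimately have "?A (ws @ [(c, d + b)]) ^^ N = id" by simp
        moreover have "length (ws @ [(c, d + b)]) < length ps"
          using arg_cong[OF ws, of length] unfolding ps by simp
        moreover have "sum_list (map fst ps) = sum_list (map fst (ws @ [(c, d + b)])) + a"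
          using arg_cong[OF ws, of "\<lambda>x. sum_list (map fst x)"] unfolding ps by simp
        moreover have "sum_list (map snd ps) = sum_list (map snd (ws @ [(c, d + b)]))"
          using arg_cong[OF ws, of "\<lambda>x. sum_list (map snd x)"] unfolding ps by simp
        ultimately show False using 1 a by (metis dvd_add)
      next
        \<comment> \<open>Symmetrically, rotate (a, b) to the front, so that X^a merges with the
          X-power of the pair after it.\<close>
        assume b: "k dvd b"
        obtain ws c d where ws: "vs @ us = (c, d) # ws"
          using ne by (metis list.exhaust surj_pair)
        have "?A ((a, b) # vs @ us) ^^ N = id"
          using rot[of us "(a, b) # vs"] eq unfolding ps by simp
        moreover have "?A ((a, b) # vs @ us) = ?A ((a + c, d) # ws)"
          unfolding ws by (simp add: Y0[OF b] funpow_add comp_assoc)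
        ultimately have "?A ((a + c, d) # ws) ^^ N = id" by simp
        moreover have "length ((a + c, d) # ws) < length ps"
          using arg_cong[OF ws, of length] unfolding ps by simp
        moreover have "sum_list (map fst ps) = sum_list (map fst ((a + c, d) # ws))"
          using arg_cong[OF ws, of "\<lambda>x. sum_list (map fst x)"] unfolding ps by simp
        moreover have "sum_list (map snd ps) = sum_list (map snd ((a + c, d) # ws)) + b"
          using arg_cong[OF ws, of "\<lambda>x. sum_list (map snd x)"] unfolding ps by simp
        ultimately show False using 1 b by (metis dvd_add)
      qed
    qed
  qed
qed

text \<open>Over the polynomial ring in t, these are the matrices with rows (1, t), (0, a) and
  (1, 0), (t, b).\<close>

definition upper_shear :: "complex \<Rightarrow> complex poly \<times> complex poly \<Rightarrow> complex poly \<times> complex poly" where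
  "upper_shear \<alpha> = (\<lambda>(p, q). (p + pCons 0 q, smult \<alpha> q))"

definition lower_shear :: "complex \<Rightarrow> complex poly \<times> complex poly \<Rightarrow> complex poly \<times> complex poly" where
  "lower_shear \<beta> = (\<lambda>(p, q). (p, pCons 0 p + smult \<beta> q))"

lemma upper_shear_funpow:
  "(upper_shear \<alpha> ^^ a) (p, q) = (p + smult (\<Sum>i<a. \<alpha> ^ i) (pCons 0 q), smult (\<alpha> ^ a) q)"
  by (induction a) (auto simp: upper_shear_def smult_add_left)

lemma lower_shear_funpow:
  "(lower_shear \<beta> ^^ b) (p, q) = (p, smult (\<Sum>i<b. \<beta> ^ i) (pCons 0 p) + smult (\<beta> ^ b) q)"
  by (induction b arbitrary: q)
    (auto simp: funpow_Suc_right lower_shear_def smult_add_left smult_add_right add_ac mult_ac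
      simp del: funpow.simps(2))

text \<open>A ping-pong argument by degree. If the first entry dominates, a power of the lower shear
  makes the second entry one degree larger than the first, and the following power of the upper
  shear makes the first entry one degree larger still. The alternative q = 0 covers the starting
  vector (1, 0).\<close>

lemma degree_alternating_shears:
  assumes "\<alpha> \<noteq> 0"
    and "\<forall>(a, b) \<in> set ps. (\<Sum>i<a. \<alpha> ^ i) \<noteq> 0 \<and> (\<Sum>i<b. \<beta> ^ i) \<noteq> 0"
    and "alternating (upper_shear \<alpha>) (lower_shear \<beta>) ps (1, 0) = (p, q)"
  shows "degree p = 2 * length ps \<and> p \<noteq> 0 \<and> (q = 0 \<or> degree q < degree p)"
  using assms(2,3)
proof (induction ps arbitrary: p q)
  case (Cons x ps)
  obtain a b where x: "x = (a, b)" by (cases x)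
  obtain p0 q0 where pq0: "alternating (upper_shear \<alpha>) (lower_shear \<beta>) ps (1, 0) = (p0, q0)"
    by (meson surj_pair)
  have IH: "degree p0 = 2 * length ps" "p0 \<noteq> 0" "q0 = 0 \<or> degree q0 < degree p0"
    using Cons.IH[OF _ pq0] Cons.prems(1) by auto
  define s r where "s = (\<Sum>i<a. \<alpha> ^ i)" and "r = (\<Sum>i<b. \<beta> ^ i)"
  have sr: "s \<noteq> 0" "r \<noteq> 0" using Cons.prems(1) by (auto simp: x s_def r_def)
  define q1 where "q1 = smult r (pCons 0 p0) + smult (\<beta> ^ b) q0"
  have pq: "p = p0 + smult s (pCons 0 q1)" "q = smult (\<alpha> ^ a) q1"
    using Cons.prems(2)
    by (auto simp: x pq0 lower_shear_funpow upper_shear_funpow s_def r_def q1_def)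
  \<comment> \<open>The term with \<open>p0\<close> wins: its geometric sum r is non-zero, and
    \<open>q0\<close> has smaller degree than \<open>p0\<close> or is zero.\<close>
  have "degree (smult (\<beta> ^ b) q0) < degree (smult r (pCons 0 p0))"
    using IH sr by (auto intro: le_less_trans[OF degree_smult_le])
  then have q1: "degree q1 = Suc (degree p0)"
    unfolding q1_def using degree_add_eq_left IH sr by fastforce
  then have q1': "q1 \<noteq> 0" by auto
  then have "degree p0 < degree (smult s (pCons 0 q1))" using sr q1 by auto
  then have "degree p = degree (smult s (pCons 0 q1))"
    unfolding pq by (rule degree_add_eq_right)
  then have "degree p = Suc (degree q1)" using sr q1' by simp
  then show ?case using q1 IH(1) pq(2) assms(1) by auto
qed auto

text \<open>Take a primitive m-th root of unity. As it differs from 1, the geometric sum is the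
  quotient of \<alpha>^a - 1 by \<alpha> - 1 and vanishes exactly when \<alpha>^a = 1.\<close>

lemma primitive_root_geometric_sum:
  assumes "m \<ge> 2"
  obtains \<alpha> :: complex where "\<alpha> \<noteq> 0" "\<alpha> ^ m = 1" "\<And>a. (\<Sum>i<a. \<alpha> ^ i) = 0 \<longleftrightarrow> m dvd a"
proof -
  define \<alpha> :: complex where "\<alpha> = exp (2 * of_real pi * \<i> * of_nat 1 / of_nat m)"
  have pow: "\<alpha> ^ a = 1 \<longleftrightarrow> m dvd a" for a
  proof -
    have "\<alpha> ^ a = exp (2 * of_real pi * \<i> * of_nat a / of_nat m)"
      unfolding \<alpha>_def by (simp add: exp_of_nat_mult[symmetric] mult_ac)
    then show ?thesis using complex_root_unity_eq_1[of m a] assms by auto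
  qed
  have "\<alpha> \<noteq> 1" using pow[of 1] assms by auto
  then have "(\<Sum>i<a. \<alpha> ^ i) = 0 \<longleftrightarrow> m dvd a" for a
    using pow[of a] by (simp add: geometric_sum)
  moreover have "\<alpha> \<noteq> 0" unfolding \<alpha>_def by simp
  ultimately show ?thesis using that pow[of m] by auto
qed

text \<open>The shears at primitive roots of unity have orders dividing m and k. A non-empty word
  without trivial syllables moves (1, 0), since it gives the first entry positive degree.\<close>

lemma free_product_cyclic_representation:
  assumes "m \<ge> 2" "k \<ge> 2"
  obtains X Y :: "complex poly \<times> complex poly \<Rightarrow> complex poly \<times> complex poly"
  where "X ^^ m = id" "Y ^^ k = id"
    "\<And>ps. ps \<noteq> [] \<Longrightarrow> \<forall>(a, b) \<in> set ps. \<not> m dvd a \<and> \<not> k dvd b \<Longrightarrow> alternating X Y ps \<noteq> id"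
proof -
  obtain \<alpha> :: complex where \<alpha>: "\<alpha> \<noteq> 0" "\<alpha> ^ m = 1" "\<And>a. (\<Sum>i<a. \<alpha> ^ i) = 0 \<longleftrightarrow> m dvd a"
    using primitive_root_geometric_sum[OF assms(1)] by blast
  obtain \<beta> :: complex where \<beta>: "\<beta> \<noteq> 0" "\<beta> ^ k = 1" "\<And>a. (\<Sum>i<a. \<beta> ^ i) = 0 \<longleftrightarrow> k dvd a"
    using primitive_root_geometric_sum[OF assms(2)] by blast
  have "alternating (upper_shear \<alpha>) (lower_shear \<beta>) ps \<noteq> id"
    if "ps \<noteq> []" "\<forall>(a, b) \<in> set ps. \<not> m dvd a \<and> \<not> k dvd b" for ps
  proof
    assume "alternating (upper_shear \<alpha>) (lower_shear \<beta>) ps = id"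
    then have "alternating (upper_shear \<alpha>) (lower_shear \<beta>) ps (1, 0) = (1, 0)" by simp
    from degree_alternating_shears[OF \<alpha>(1) _ this] have "degree (1 :: complex poly) = 2 * length ps"
      using that(2) \<alpha>(3) \<beta>(3) by auto
    then show False using that(1) by simp
  qed
  moreover have "upper_shear \<alpha> ^^ m = id" "lower_shear \<beta> ^^ k = id"
    using \<alpha> \<beta> by (auto simp: fun_eq_iff upper_shear_funpow lower_shear_funpow)
  ultimately show ?thesis using that by blast
qed

section \<open>Integer matrices invertible modulo p\<close>

lemma cong_det:
  fixes A B :: "int Matrix.mat"
  assumes "A \<in> carrier_mat k k" "B \<in> carrier_mat k k"
    and "\<And>i j. i < k \<Longrightarrow> j < k \<Longrightarrow> [A $$ (i, j) = B $$ (i, j)] (mod p)"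
  shows "[Determinant.det A = Determinant.det B] (mod p)"
proof -
  have "[signof \<sigma> * (\<Prod>i = 0..<k. A $$ (i, \<sigma> i)) = signof \<sigma> * (\<Prod>i = 0..<k. B $$ (i, \<sigma> i))] (mod p)"
    if "\<sigma> permutes {0..<k}" for \<sigma>
    using permutes_in_image[OF that]
    by (intro cong_mult cong_refl cong_prod assms(3)) auto
  then show ?thesis using assms(1,2) by (auto simp: Determinant.det_def intro!: cong_sum)
qed

text \<open>The determinant of A is a unit modulo p, so some Leibniz term is not divisible by p, and
  neither is any of its factors; its permutation is the matching. It suffices that p is not a
  unit.\<close>

lemma matching_of_left_inverse_mod:
  fixes A :: "'b \<Rightarrow> 'a \<Rightarrow> int" and B :: "'a \<Rightarrow> 'b \<Rightarrow> int"
  assumes "finite U" "finite T" "card T \<le> card U" "\<not> p dvd 1"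
    and BA: "\<And>u u'. u \<in> U \<Longrightarrow> u' \<in> U \<Longrightarrow>
      [(\<Sum>t\<in>T. B u t * A t u') = (if u = u' then 1 else 0)] (mod p)"
  obtains f where "inj_on f U" "f ` U \<subseteq> T" "\<And>u. u \<in> U \<Longrightarrow> \<not> p dvd A (f u) u"
proof -
  define k l where "k = card U" and "l = card T"
  obtain x where x: "bij_betw x {0..<k} U" using ex_bij_betw_nat_finite[OF assms(1)] k_def by blast
  obtain y where y: "bij_betw y {0..<l} T" using ex_bij_betw_nat_finite[OF assms(2)] l_def by blast
  have lk: "l \<le> k" using assms(3) by (simp add: k_def l_def)
  \<comment> \<open>Padding A by zero rows to a square matrix: a non-zero term of its determinant shows that
    there was nothing to pad.\<close>
  define A' where "A' = Matrix.mat k k (\<lambda>(i, j). if i < l then A (y i) (x j) else 0)"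
  define B' where "B' = Matrix.mat k k (\<lambda>(i, j). if j < l then B (x i) (y j) else 0)"
  have car: "A' \<in> carrier_mat k k" "B' \<in> carrier_mat k k" by (auto simp: A'_def B'_def)
  have "[(B' * A') $$ (i, j) = 1\<^sub>m k $$ (i, j)] (mod p)" if ij: "i < k" "j < k" for i j
  proof -
    have "(B' * A') $$ (i, j) = (\<Sum>s = 0..<k. if s < l then B (x i) (y s) * A (y s) (x j) else 0)"
      using ij by (auto simp: A'_def B'_def scalar_prod_def intro!: sum.cong)
    also have "\<dots> = (\<Sum>s = 0..<l. B (x i) (y s) * A (y s) (x j))"
      using lk by (intro sum.mono_neutral_cong_right) auto
    also have "\<dots> = (\<Sum>t\<in>T. B (x i) t * A t (x j))"
      by (rule sum.reindex_bij_betw[OF y])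
    finally show ?thesis
      using BA[of "x i" "x j"] ij x by (auto simp: bij_betw_def inj_on_eq_iff)
  qed
  then have "[Determinant.det (B' * A') = Determinant.det (1\<^sub>m k)] (mod p)" using car by (intro cong_det) auto
  then have "[Determinant.det B' * Determinant.det A' = 1] (mod p)" using det_mult[OF car(2,1)] by simp
  then have "\<not> p dvd Determinant.det A'" using assms(4) by (metis cong_dvd_iff dvd_mult)
  then obtain \<sigma> where \<sigma>: "\<sigma> permutes {0..<k}" "\<not> p dvd (\<Prod>i = 0..<k. A' $$ (i, \<sigma> i))"
    unfolding det_def'[OF car(1)] by (metis (no_types, lifting) dvd_mult dvd_sum mem_Collect_eq)
  \<comment> \<open>A padded row would contribute a zero factor, so every row index of the non-zero
    term is below l.\<close>
  have entry: "i < l \<and> \<not> p dvd A (y i) (x (\<sigma> i))" if i: "i < k" for i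
  proof -
    have "\<not> p dvd A' $$ (i, \<sigma> i)" using \<sigma>(2) i by (meson atLeastLessThan_iff dvd_prodI dvd_trans finite_atLeastLessThan zero_le)
    moreover have "\<sigma> i < k" using permutes_in_image[OF \<sigma>(1)] i by simp
    ultimately show ?thesis using i by (auto simp: A'_def split: if_splits)
  qed
  \<comment> \<open>\<open>g u\<close> is the row that the chosen permutation pairs with the column
    u.\<close>
  define g where "g = inv_into {0..<k} (x \<circ> \<sigma>)"
  have "bij_betw (x \<circ> \<sigma>) {0..<k} U" using permutes_imp_bij[OF \<sigma>(1)] x by (rule bij_betw_trans)
  then have g: "bij_betw g U {0..<k}" "\<And>u. u \<in> U \<Longrightarrow> x (\<sigma> (g u)) = u"
    unfolding g_def by (auto intro: bij_betw_inv_into dest: bij_betw_inv_into_right)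
  have gl: "g u < l" "\<not> p dvd A (y (g u)) u" if "u \<in> U" for u
    using entry[of "g u"] g bij_betwE[OF g(1)] that by auto
  show ?thesis
  proof (rule that[of "y \<circ> g"])
    show "inj_on (y \<circ> g) U"
      using g(1) y gl by (auto intro!: comp_inj_on simp: bij_betw_def intro: inj_on_subset)
    show "(y \<circ> g) ` U \<subseteq> T" using gl y by (auto simp: bij_betw_def)
  qed (use gl in auto)
qed

section \<open>Graph products\<close>

lemma words_simps [simp]:
  "[] \<in> words V"
  "x # w \<in> words V \<longleftrightarrow> fst x \<in> V \<and> w \<in> words V"
  "a @ b \<in> words V \<longleftrightarrow> a \<in> words V \<and> b \<in> words V"
  "concat (replicate N w) \<in> words V \<longleftrightarrow> N = 0 \<or> w \<in> words V"
  by (auto simp: words_def lists_eq_set mem_Times_iff)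

lemma replicate_in_words [simp]: "v \<in> V \<Longrightarrow> replicate N (v, b) \<in> words V"
  by (auto simp: words_def lists_eq_set)

lemma weq_words: "weq V E n a b \<Longrightarrow> a \<in> words V \<and> b \<in> words V"
  by (induction rule: weq.induct) auto

lemma weq_append:
  assumes "weq V E n a a'" "weq V E n b b'"
  shows "weq V E n (a @ b) (a' @ b')"
proof -
  have "weq V E n (a @ b) (a' @ b)"
    using weq.ctxt[OF assms(1), of "[]" b] weq_words[OF assms(2)] by simp
  moreover have "weq V E n (a' @ b) (a' @ b')"
    using weq.ctxt[OF assms(2), of a' "[]"] weq_words[OF assms(1)] by simp
  ultimately show ?thesis by (rule weq.trans)
qed

lemma wclass_eq_iff:
  assumes "b \<in> words V"
  shows "wclass V E n a = wclass V E n b \<longleftrightarrow> weq V E n a b"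
  unfolding wclass_def using assms by (blast intro: weq.refl weq.sym weq.trans)

definition word_inv :: "('a \<times> bool) list \<Rightarrow> ('a \<times> bool) list" where
  "word_inv w = rev (map (\<lambda>(v, b). (v, \<not> b)) w)"

lemma word_inv_in_words [simp]: "word_inv w \<in> words V \<longleftrightarrow> w \<in> words V"
  by (induction w) (auto simp: word_inv_def)

lemma weq_word_inv:
  assumes "w \<in> words V"
  shows "weq V E n (word_inv w @ w) []"
  using assms
proof (induction w)
  case (Cons x w)
  obtain v b where x: "x = (v, b)" by (cases x)
  have "weq V E n (word_inv w @ [(v, \<not> b), (v, \<not> \<not> b)] @ w) (word_inv w @ [] @ w)"
    using Cons.prems x by (intro weq.ctxt weq.cancel) auto
  then have "weq V E n (word_inv (x # w) @ x # w) (word_inv w @ w)"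
    by (simp add: word_inv_def x)
  then show ?case using Cons weq.trans by fastforce
qed (simp add: word_inv_def weq.refl)

context
  fixes V :: "'a set" and E :: "'a \<Rightarrow> 'a \<Rightarrow> bool" and n :: "'a \<Rightarrow> nat"
begin

lemma carrier_graph_product: "carrier (graph_product V E n) = wclass V E n ` words V"
  by (simp add: graph_product_def)

lemma one_graph_product: "\<one>\<^bsub>graph_product V E n\<^esub> = wclass V E n []"
  by (simp add: graph_product_def)

lemma wclass_closed [simp]: "w \<in> words V \<Longrightarrow> wclass V E n w \<in> carrier (graph_product V E n)"
  by (simp add: carrier_graph_product)

lemma gen_closed [simp]: "v \<in> V \<Longrightarrow> gen V E n v \<in> carrier (graph_product V E n)"
  by (simp add: gen_def)

lemma wclass_mult:
  assumes "a \<in> words V" "b \<in> words V"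
  shows "wclass V E n a \<otimes>\<^bsub>graph_product V E n\<^esub> wclass V E n b = wclass V E n (a @ b)"
proof -
  have "(\<exists>x. weq V E n a x \<and> (\<exists>y. weq V E n b y \<and> weq V E n (x @ y) c)) \<longleftrightarrow> weq V E n (a @ b) c" for c
    using assms by (meson weq.refl weq.trans weq_append)
  then show ?thesis by (auto simp: graph_product_def wclass_def)
qed

lemma group_graph_product: "group (graph_product V E n)"
proof (rule groupI)
  fix x assume "x \<in> carrier (graph_product V E n)"
  then obtain w where w: "x = wclass V E n w" "w \<in> words V" by (auto simp: carrier_graph_product)
  then have "wclass V E n (word_inv w) \<otimes>\<^bsub>graph_product V E n\<^esub> x = \<one>\<^bsub>graph_product V E n\<^esub>"
    by (simp add: wclass_mult one_graph_product wclass_eq_iff weq_word_inv)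
  then show "\<exists>y\<in>carrier (graph_product V E n). y \<otimes>\<^bsub>graph_product V E n\<^esub> x = \<one>\<^bsub>graph_product V E n\<^esub>" using w by force
qed (auto simp: carrier_graph_product one_graph_product wclass_mult)

lemma wclass_pow:
  assumes "w \<in> words V"
  shows "wclass V E n w [^]\<^bsub>graph_product V E n\<^esub> N = wclass V E n (concat (replicate N w))"
proof (induction N)
  case (Suc N)
  have "concat (replicate N w) @ w = concat (replicate (Suc N) w)"
    by (simp add: replicate_append_same[symmetric])
  then show ?case using Suc assms by (simp add: wclass_mult del: replicate_Suc)
qed (simp add: one_graph_product)

lemma gen_pow_label:
  assumes "v \<in> V"
  shows "gen V E n v [^]\<^bsub>graph_product V E n\<^esub> n v = \<one>\<^bsub>graph_product V E n\<^esub>"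
proof -
  have "concat (replicate N [(v, True)]) = replicate N (v, True)" for N by (induction N) auto
  then show ?thesis
    using assms weq.power[of v V E n]
    by (simp add: gen_def wclass_pow one_graph_product wclass_eq_iff)
qed

lemma gen_commute:
  assumes "E u v" "u \<in> V" "v \<in> V"
  shows "gen V E n u \<otimes>\<^bsub>graph_product V E n\<^esub> gen V E n v = gen V E n v \<otimes>\<^bsub>graph_product V E n\<^esub> gen V E n u"
  using assms weq.comm[of E u v V n True True]
  by (simp add: gen_def wclass_mult wclass_eq_iff)

end

section \<open>Exponent sums and coordinates in the abelianization\<close>

primrec exponent_sum :: "'a \<Rightarrow> ('a \<times> bool) list \<Rightarrow> int" where
  "exponent_sum v [] = 0"
| "exponent_sum v (x # w) = (if fst x = v then if snd x then 1 else -1 else 0) + exponent_sum v w"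

lemma exponent_sum_append: "exponent_sum v (a @ b) = exponent_sum v a + exponent_sum v b"
  by (induction a) auto

lemma exponent_sum_replicate:
  "exponent_sum v (replicate N (u, True)) = (if u = v then int N else 0)"
  by (induction N) auto

lemma exponent_sum_nonzero_imp_mem: "exponent_sum v w \<noteq> 0 \<Longrightarrow> v \<in> fst ` set w"
  by (induction w) (auto split: if_splits)

text \<open>Cancellation and commutation preserve exponent sums, and the power relation changes one
  of them by the order of its vertex group.\<close>

lemma weq_exponent_sum:
  "weq V E n a b \<Longrightarrow> [exponent_sum v a = exponent_sum v b] (mod int (n v))"
proof (induction rule: weq.induct)
  case (power u)
  then show ?case by (simp add: exponent_sum_replicate cong_def)
next
  case (ctxt a b x y)
  then show ?case unfolding exponent_sum_append by (intro cong_add cong_refl)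
next
  case (sym a b)
  then show ?case by (simp add: cong_sym_eq)
next
  case (trans a b c)
  then show ?case using cong_trans by blast
qed simp_all

text \<open>The v-coordinate in the abelianization, an integer that is only meaningful modulo the
  order of the vertex group.\<close>

definition coord :: "'a \<Rightarrow> ('a \<times> bool) list set \<Rightarrow> int" where
  "coord v g = exponent_sum v (SOME w. w \<in> g)"

lemma coord_wclass:
  assumes "w \<in> words V"
  shows "[coord v (wclass V E n w) = exponent_sum v w] (mod int (n v))"
proof -
  have "w \<in> wclass V E n w" using assms by (simp add: wclass_def weq.refl)
  then have "(SOME w'. w' \<in> wclass V E n w) \<in> wclass V E n w" by (rule someI)
  then show ?thesis
    unfolding coord_def by (auto simp: wclass_def intro: cong_sym weq_exponent_sum)
qed

lemma coord_mult:
  assumes "g \<in> carrier (graph_product V E n)" "h \<in> carrier (graph_product V E n)"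
  shows "[coord v (g \<otimes>\<^bsub>graph_product V E n\<^esub> h) = coord v g + coord v h] (mod int (n v))"
proof -
  obtain a b where ab: "g = wclass V E n a" "a \<in> words V" "h = wclass V E n b" "b \<in> words V"
    using assms by (auto simp: carrier_graph_product)
  have "[coord v (g \<otimes>\<^bsub>graph_product V E n\<^esub> h) = exponent_sum v a + exponent_sum v b] (mod int (n v))"
    using coord_wclass[of "a @ b" V v E n] ab by (simp add: wclass_mult exponent_sum_append)
  moreover have "[exponent_sum v a + exponent_sum v b = coord v g + coord v h] (mod int (n v))"
    unfolding ab(1,3) using ab(2,4) by (intro cong_add cong_sym[OF coord_wclass])
  ultimately show ?thesis by (rule cong_trans)
qed

lemma coord_one: "[coord v \<one>\<^bsub>graph_product V E n\<^esub> = 0] (mod int (n v))"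
  using coord_wclass[of "[]" V v E n] by (simp add: one_graph_product)

lemma coord_gen:
  assumes "u \<in> V"
  shows "[coord v (gen V E n u) = (if u = v then 1 else 0)] (mod int (n v))"
  using coord_wclass[of "[(u, True)]" V v E n] assms
  by (cases "u = v") (simp_all add: gen_def)

lemma coord_inv:
  assumes "g \<in> carrier (graph_product V E n)"
  shows "[coord v (inv\<^bsub>graph_product V E n\<^esub> g) = - coord v g] (mod int (n v))"
proof -
  interpret group "graph_product V E n" by (rule group_graph_product)
  have "[coord v \<one>\<^bsub>graph_product V E n\<^esub>
      = coord v (inv\<^bsub>graph_product V E n\<^esub> g) + coord v g] (mod int (n v))"
    using coord_mult[of "inv\<^bsub>graph_product V E n\<^esub> g" V E n g v] assms by simp
  from cong_trans[OF cong_sym[OF this] coord_one]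
  have "[coord v (inv\<^bsub>graph_product V E n\<^esub> g) + coord v g = 0] (mod int (n v))" .
  then show ?thesis by (simp add: cong_iff_dvd_diff add.commute)
qed

lemma coord_conjugate:
  assumes "g \<in> carrier (graph_product V E n)" "w \<in> carrier (graph_product V E n)"
  shows "[coord v (w \<otimes>\<^bsub>graph_product V E n\<^esub> g \<otimes>\<^bsub>graph_product V E n\<^esub> inv\<^bsub>graph_product V E n\<^esub> w)
    = coord v g] (mod int (n v))"
proof -
  let ?G = "graph_product V E n"
  interpret group "graph_product V E n" by (rule group_graph_product)
  have "[coord v (w \<otimes>\<^bsub>?G\<^esub> g \<otimes>\<^bsub>?G\<^esub> inv\<^bsub>?G\<^esub> w) = coord v (w \<otimes>\<^bsub>?G\<^esub> g) + coord v (inv\<^bsub>?G\<^esub> w)] (mod int (n v))"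
    using assms by (intro coord_mult) auto
  also have "[coord v (w \<otimes>\<^bsub>?G\<^esub> g) + coord v (inv\<^bsub>?G\<^esub> w) = (coord v w + coord v g) + - coord v w] (mod int (n v))"
    using assms by (intro cong_add coord_mult coord_inv) auto
  finally show ?thesis by simp
qed

text \<open>Every conjugate of g has the same non-zero v-coordinate, so any word representing it has
  non-zero exponent sum at v and must contain that letter; a reduced word exists by taking a
  shortest one.\<close>

lemma coord_imp_mem_csupp:
  assumes "g \<in> carrier (graph_product V E n)" "v \<in> V" "\<not> int (n v) dvd coord v g"
  shows "v \<in> csupp V E n g"
proof -
  let ?G = "graph_product V E n"
  interpret group "graph_product V E n" by (rule group_graph_product)
  have "v \<in> supp V E n (x \<otimes>\<^bsub>?G\<^esub> g \<otimes>\<^bsub>?G\<^esub> inv\<^bsub>?G\<^esub> x)" if x: "x \<in> carrier (graph_product V E n)" for x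
  proof -
    have "x \<otimes>\<^bsub>?G\<^esub> g \<otimes>\<^bsub>?G\<^esub> inv\<^bsub>?G\<^esub> x \<in> carrier (graph_product V E n)" using assms x by simp
    then obtain w0 where w0: "x \<otimes>\<^bsub>?G\<^esub> g \<otimes>\<^bsub>?G\<^esub> inv\<^bsub>?G\<^esub> x = wclass V E n w0" "w0 \<in> words V"
      by (auto simp: carrier_graph_product)
    obtain w where w: "weq V E n w0 w" "\<And>w'. weq V E n w0 w' \<Longrightarrow> length w \<le> length w'"
      using ex_has_least_nat[of "weq V E n w0" w0 length] weq.refl[OF w0(2)] by blast
    have "reduced V E n w"
      unfolding reduced_def using w weq_words[OF w(1)] by (blast intro: weq.trans)
    moreover have "w \<in> x \<otimes>\<^bsub>?G\<^esub> g \<otimes>\<^bsub>?G\<^esub> inv\<^bsub>?G\<^esub> x" using w(1) w0(1) by (simp add: wclass_def)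
    moreover have "[exponent_sum v w = coord v g] (mod int (n v))"
      by (rule cong_trans[OF cong_sym[OF weq_exponent_sum[OF w(1)]]
          cong_trans[OF cong_sym[OF coord_wclass[OF w0(2), where E = E]]
            coord_conjugate[OF assms(1) x, unfolded w0(1)]]])
    then have "exponent_sum v w \<noteq> 0"
      using assms(3) by (auto simp: cong_0_iff cong_sym_eq[of 0])
    ultimately show ?thesis
      using exponent_sum_nonzero_imp_mem[of v w] by (auto simp: supp_def)
  qed
  then show ?thesis using assms(2) by (simp add: csupp_def)
qed

text \<open>On abelianizations h acts by the integer matrix with entries
  \<open>coord t (h (gen V1 E1 n1 u))\<close>.\<close>

lemma coord_hom_wclass:
  assumes "finite V1" "h \<in> hom (graph_product V1 E1 n1) (graph_product V2 E2 n2)" "w \<in> words V1"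
  shows "[coord t (h (wclass V1 E1 n1 w))
    = (\<Sum>u\<in>V1. exponent_sum u w * coord t (h (gen V1 E1 n1 u)))] (mod int (n2 t))"
  using assms(3)
proof (induction w)
  case Nil
  interpret group_hom "graph_product V1 E1 n1" "graph_product V2 E2 n2" h
    by (intro group_hom.intro group_hom_axioms.intro group_graph_product assms)
  show ?case using coord_one[of t V2 E2 n2] by (simp flip: one_graph_product[of V1 E1 n1])
next
  case (Cons x w)
  interpret group_hom "graph_product V1 E1 n1" "graph_product V2 E2 n2" h
    by (intro group_hom.intro group_hom_axioms.intro group_graph_product assms)
  let ?c = "\<lambda>w. coord t (h (wclass V1 E1 n1 w))"
  let ?M = "\<lambda>u. coord t (h (gen V1 E1 n1 u))"
  obtain v b where x: "x = (v, b)" by (cases x)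
  have v: "v \<in> V1" and w: "w \<in> words V1" using Cons.prems x by auto
  have split: "[?c (a @ c) = ?c a + ?c c] (mod int (n2 t))" if "a \<in> words V1" "c \<in> words V1" for a c
    using coord_mult[of "h (wclass V1 E1 n1 a)" V2 E2 n2 "h (wclass V1 E1 n1 c)" t] that
    by (simp flip: wclass_mult)
  \<comment> \<open>A positive letter is a generator by definition; for a negative one, the
    coordinates of the images of v and its inverse add up to zero.\<close>
  have letter: "[?c [x] = (if b then 1 else -1) * ?M v] (mod int (n2 t))"
  proof (cases b)
    case True
    then show ?thesis by (simp add: x gen_def)
  next
    case False
    have "[?c [(v, True)] + ?c [(v, False)] = 0] (mod int (n2 t))"
    proof -
      have "wclass V1 E1 n1 ([(v, True)] @ [(v, False)]) = wclass V1 E1 n1 []"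
        using v weq.cancel[of v V1 E1 n1 True] by (simp add: wclass_eq_iff)
      then have "h (wclass V1 E1 n1 ([(v, True)] @ [(v, False)])) = \<one>\<^bsub>graph_product V2 E2 n2\<^esub>"
        by (simp only: flip: one_graph_product[of V1 E1 n1]) simp
      then have "[coord t \<one>\<^bsub>graph_product V2 E2 n2\<^esub> = ?c [(v, True)] + ?c [(v, False)]] (mod int (n2 t))"
        using split[of "[(v, True)]" "[(v, False)]"] v by simp
      from cong_trans[OF cong_sym[OF this] coord_one] show ?thesis .
    qed
    then show ?thesis using False by (simp add: x gen_def cong_iff_dvd_diff add.commute)
  qed
  have "[?c ([x] @ w) = ?c [x] + ?c w] (mod int (n2 t))"
    using v w x by (intro split) auto
  also have "[?c [x] + ?c w = (if b then 1 else -1) * ?M v + (\<Sum>u\<in>V1. exponent_sum u w * ?M u)] (mod int (n2 t))"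
    using letter Cons.IH[OF w] by (rule cong_add)
  also have "(if b then 1 else -1) * ?M v + (\<Sum>u\<in>V1. exponent_sum u w * ?M u)
      = (\<Sum>u\<in>V1. (if u = v then (if b then 1 else -1) * ?M u else 0) + exponent_sum u w * ?M u)"
    using v assms(1) by (simp only: sum.distrib sum.delta if_True)
  also have "\<dots> = (\<Sum>u\<in>V1. exponent_sum u (x # w) * ?M u)"
    by (intro sum.cong) (auto simp: x algebra_simps)
  finally show ?case by simp
qed

text \<open>The coordinates of g are meaningful modulo the labels in \<open>n1\<close>, but the
  congruence is modulo \<open>n2 t\<close>. It is therefore derived for the very word that
  \<open>coord\<close> selects, with its actual exponent sums.\<close>

lemma coord_hom_gen:
  assumes "finite V1" "h \<in> hom (graph_product V1 E1 n1) (graph_product V2 E2 n2)"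
    and "g \<in> carrier (graph_product V1 E1 n1)"
  shows "[coord t (h g) = (\<Sum>u\<in>V1. coord u g * coord t (h (gen V1 E1 n1 u)))] (mod int (n2 t))"
proof -
  obtain w0 where w0: "g = wclass V1 E1 n1 w0" "w0 \<in> words V1"
    using assms(3) by (auto simp: carrier_graph_product)
  define w where "w = (SOME w. w \<in> g)"
  have "w0 \<in> g" using w0 by (simp add: wclass_def weq.refl)
  then have "w \<in> g" unfolding w_def by (rule someI)
  then have "weq V1 E1 n1 w0 w" using w0 by (simp add: wclass_def)
  then have "g = wclass V1 E1 n1 w" "w \<in> words V1" using w0 weq_words wclass_eq_iff by metis+
  then show ?thesis
    using coord_hom_wclass[OF assms(1,2), of w t] by (simp add: coord_def w_def)
qed

text \<open>The image of a generator is killed by the order of that generator. This limits the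
  matrix entries between vertices with different labels.\<close>

lemma label_mult_coord_hom:
  assumes "finite V1" "h \<in> hom (graph_product V1 E1 n1) (graph_product V2 E2 n2)" "u \<in> V1"
  shows "int (n2 t) dvd int (n1 u) * coord t (h (gen V1 E1 n1 u))"
proof -
  interpret group_hom "graph_product V1 E1 n1" "graph_product V2 E2 n2" h
    by (intro group_hom.intro group_hom_axioms.intro group_graph_product assms)
  let ?w = "replicate (n1 u) (u, True)"
  have "wclass V1 E1 n1 ?w = \<one>\<^bsub>graph_product V1 E1 n1\<^esub>"
    using weq.power[of u V1 E1 n1] assms(3) by (simp add: one_graph_product wclass_eq_iff)
  then have "[coord t (h (wclass V1 E1 n1 ?w)) = 0] (mod int (n2 t))"
    using coord_one[of t V2 E2 n2] by simp
  moreover have "(\<Sum>v\<in>V1. exponent_sum v ?w * coord t (h (gen V1 E1 n1 v)))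
      = int (n1 u) * coord t (h (gen V1 E1 n1 u))"
    using assms(1,3) by (simp add: exponent_sum_replicate if_distrib[of "\<lambda>x. x * _"] cong: if_cong)
  ultimately show ?thesis
    using coord_hom_wclass[OF assms(1,2), of ?w t] assms(3) by (simp add: cong_0_iff cong_dvd_iff)
qed

subsection \<open>Torsion elements\<close>

text \<open>An inverse letter acts by the power n v - 1, so no inverse functions are needed once f v
  has order dividing n v.\<close>

primrec word_action :: "('a \<Rightarrow> 'c \<Rightarrow> 'c) \<Rightarrow> ('a \<Rightarrow> nat) \<Rightarrow> ('a \<times> bool) list \<Rightarrow> 'c \<Rightarrow> 'c" where
  "word_action f n [] = id"
| "word_action f n (x # w) = (f (fst x) ^^ (if snd x then 1 else n (fst x) - 1)) \<circ> word_action f n w"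

lemma word_action_append: "word_action f n (a @ b) = word_action f n a \<circ> word_action f n b"
  by (induction a) (auto simp: comp_assoc)

lemma word_action_concat_replicate:
  "word_action f n (concat (replicate N w)) = word_action f n w ^^ N"
  by (induction N) (auto simp: word_action_append)

lemma weq_word_action:
  assumes "\<And>v. v \<in> V \<Longrightarrow> f v ^^ n v = id" "\<And>v. v \<in> V \<Longrightarrow> n v > 0"
    and "\<And>u v. E u v \<Longrightarrow> f u \<circ> f v = f v \<circ> f u"
  shows "weq V E n a b \<Longrightarrow> word_action f n a = word_action f n b"
proof (induction rule: weq.induct)
  case (cancel v b)
  have "f v ^^ (Suc 0 + (n v - 1)) = id" "f v ^^ ((n v - 1) + Suc 0) = id"
    using assms(1,2)[OF cancel] by simp_all
  then show ?case by (cases b) (simp_all only: funpow_add, auto)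
next
  case (power v)
  have "word_action f n (replicate N (v, True)) = f v ^^ N" for N
    by (induction N) auto
  then show ?case using assms(1)[OF power] by simp
next
  case (comm u v b c)
  have "(f u ^^ i) \<circ> f v = f v \<circ> (f u ^^ i)" for i
    by (induction i) (auto simp: fun_eq_iff assms(3)[OF comm(1), unfolded fun_eq_iff, simplified])
  then have "(f u ^^ i) \<circ> (f v ^^ j) = (f v ^^ j) \<circ> (f u ^^ i)" for i j
    by (induction j) (auto simp: fun_eq_iff)
  then show ?case by simp
qed (auto simp: word_action_append)

lemma coord_torsion_adjacent:
  fixes N :: nat
  assumes lg: "labeled_graph V E n"
    and g: "g \<in> carrier (graph_product V E n)" "g [^]\<^bsub>graph_product V E n\<^esub> N = \<one>\<^bsub>graph_product V E n\<^esub>" "N > 0"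
    and uv: "u \<in> V" "v \<in> V" "u \<noteq> v" "\<not> int (n u) dvd coord u g" "\<not> int (n v) dvd coord v g"
  shows "E u v"
proof (rule ccontr)
  assume "\<not> E u v"
  then have nE: "\<not> E u v" "\<not> E v u" using lg by (auto simp: labeled_graph_def)
  have n2: "n x \<ge> 2" if "x \<in> V" for x using lg that by (auto simp: labeled_graph_def)
  obtain X Y :: "complex poly \<times> complex poly \<Rightarrow> complex poly \<times> complex poly"
    where X: "X ^^ n u = id" and Y: "Y ^^ n v = id"
      and free: "\<And>ps. ps \<noteq> [] \<Longrightarrow> \<forall>(a, b) \<in> set ps. \<not> n u dvd a \<and> \<not> n v dvd b \<Longrightarrow> alternating X Y ps \<noteq> id"
    using free_product_cyclic_representation[OF n2[OF uv(1)] n2[OF uv(2)]] by blast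
  \<comment> \<open>This is the retraction onto the free product of the groups at u and v, followed
    by its representation. The commutation relations hold because u and v are not adjacent and all
    other generators act trivially.\<close>
  define f where "f x = (if x = u then X else if x = v then Y else id)" for x
  have inv: "word_action f n a = word_action f n b" if "weq V E n a b" for a b
  proof (rule weq_word_action[OF _ _ _ that])
    fix x assume "x \<in> V"
    then show "f x ^^ n x = id" "n x > 0" using X Y n2[of x] by (auto simp: f_def)
  next
    fix x y assume "E x y"
    then have "x \<noteq> y" using lg by (auto simp: labeled_graph_def)
    then show "f x \<circ> f y = f y \<circ> f x" using nE \<open>E x y\<close> by (auto simp: f_def)
  qed
  obtain w where w: "g = wclass V E n w" "w \<in> words V"
    using g(1) by (auto simp: carrier_graph_product)
  have "weq V E n (concat (replicate N w)) []"
    using g(2) w by (simp add: wclass_pow one_graph_product wclass_eq_iff)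
  then have triv: "word_action f n w ^^ N = id"
    using inv word_action_concat_replicate by (metis word_action.simps(1))
  \<comment> \<open>The exponent of y contributed by one letter, with n y - 1 in place of -1. Each
    letter becomes a pair with at least one zero entry, hence the need for words with trivial
    syllables.\<close>
  define e :: "'a \<Rightarrow> 'a \<times> bool \<Rightarrow> nat"
    where "e y x = (if fst x = y then if snd x then 1 else n y - 1 else 0)" for y x
  define ps where "ps = map (\<lambda>x. (e u x, e v x)) w"
  have "word_action f n w = alternating X Y ps"
    unfolding ps_def using uv(3) by (induction w) (auto simp: f_def e_def)
  then have alt: "alternating X Y ps ^^ N = id" using triv by simp
  have e: "[int (sum_list (map (e y) w)) = exponent_sum y w] (mod int (n y))" if "y \<in> V" for y
  proof -
    have "[int (e y x) = (if fst x = y then if snd x then 1 else -1 else 0)] (mod int (n y))" for x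
      using n2[OF that] by (auto simp: e_def of_nat_diff cong_iff_dvd_diff)
    then show ?thesis
      by (induction w) (simp_all only: list.map sum_list.Nil sum_list.Cons of_nat_0 of_nat_add
        exponent_sum.simps cong_refl cong_add)
  qed
  have "\<not> n y dvd sum_list (map (e y) w)" if "y \<in> V" "\<not> int (n y) dvd coord y g" for y
  proof -
    have "[int (sum_list (map (e y) w)) = coord y g] (mod int (n y))"
      using cong_trans[OF e[OF that(1)] cong_sym[OF coord_wclass[OF w(2), of y E n]]] w(1) by simp
    from cong_dvd_iff[OF this] that(2) show ?thesis by simp
  qed
  from this[OF uv(1,4)] this[OF uv(2,5)]
  have "\<not> n u dvd sum_list (map fst ps)" "\<not> n v dvd sum_list (map snd ps)"
    by (simp_all add: ps_def comp_def)
  then have "alternating X Y ps ^^ N \<noteq> id"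
    using n2[OF uv(1)] n2[OF uv(2)]
    by (intro alternating_infinite_order[OF X _ Y _ free _ _ \<open>N > 0\<close>]) simp_all
  then show False using alt by blast
qed

section \<open>Isomorphisms of graph products\<close>

text \<open>Some torsion element among u, v and the product u v has an image with non-zero
  coordinates at both s and t.\<close>

lemma coord_hom_supports_adjacent:
  assumes lg: "labeled_graph V1 E1 n1" "labeled_graph V2 E2 n2"
    and h: "h \<in> hom (graph_product V1 E1 n1) (graph_product V2 E2 n2)"
    and uv: "E1 u v"
    and st: "s \<in> V2" "t \<in> V2" "s \<noteq> t"
      "\<not> int (n2 s) dvd coord s (h (gen V1 E1 n1 u))" "\<not> int (n2 t) dvd coord t (h (gen V1 E1 n1 v))"
  shows "E2 s t"
proof -
  let ?G1 = "graph_product V1 E1 n1" and ?G2 = "graph_product V2 E2 n2"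
  let ?u = "gen V1 E1 n1 u" and ?v = "gen V1 E1 n1 v"
  interpret group_hom ?G1 ?G2 h
    by (intro group_hom.intro group_hom_axioms.intro group_graph_product h)
  have V: "u \<in> V1" "v \<in> V1" and pos: "n1 u > 0" "n1 v > 0"
    using lg(1) uv by (auto simp: labeled_graph_def, fastforce+)
  have adj: "E2 s t" if "x \<in> carrier ?G1" "x [^]\<^bsub>?G1\<^esub> N = \<one>\<^bsub>?G1\<^esub>" "N > 0"
    "\<not> int (n2 s) dvd coord s (h x)" "\<not> int (n2 t) dvd coord t (h x)" for x and N :: nat
  proof (rule coord_torsion_adjacent[OF lg(2) _ _ that(3) st(1-3) that(4,5)])
    show "h x [^]\<^bsub>?G2\<^esub> N = \<one>\<^bsub>?G2\<^esub>" using that by (simp flip: hom_nat_pow)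
  qed (use that in simp)
  show ?thesis
  \<comment> \<open>Unless the image of u vanishes at t and that of v vanishes at s, one of the two
    generators already serves.\<close>
  proof (cases "int (n2 t) dvd coord t (h ?u) \<and> int (n2 s) dvd coord s (h ?v)")
    case False
    then show ?thesis
      using adj[of ?u "n1 u"] adj[of ?v "n1 v"] st V pos gen_pow_label by fastforce
  next
    case True
    \<comment> \<open>Nothing cancels at s and t in the image of the torsion element u v.\<close>
    let ?x = "?u \<otimes>\<^bsub>?G1\<^esub> ?v"
    have "?x [^]\<^bsub>?G1\<^esub> (n1 u * n1 v) = ?u [^]\<^bsub>?G1\<^esub> (n1 u * n1 v) \<otimes>\<^bsub>?G1\<^esub> ?v [^]\<^bsub>?G1\<^esub> (n1 v * n1 u)"
      using G.pow_mult_distrib[OF gen_commute[of E1 u v V1 n1]] uv V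
      by (simp add: mult.commute[of "n1 v"])
    also have "\<dots> = \<one>\<^bsub>?G1\<^esub>"
      using V by (simp add: gen_pow_label flip: G.nat_pow_pow)
    finally have x: "?x [^]\<^bsub>?G1\<^esub> (n1 u * n1 v) = \<one>\<^bsub>?G1\<^esub>" .
    have "[coord y (h ?x) = coord y (h ?u) + coord y (h ?v)] (mod int (n2 y))" for y
      using coord_mult[of "h ?u" V2 E2 n2 "h ?v" y] V by simp
    then have "int (n2 y) dvd coord y (h ?x) \<longleftrightarrow> int (n2 y) dvd coord y (h ?u) + coord y (h ?v)" for y
      by (rule cong_dvd_iff)
    then show ?thesis
      using True st V pos by (intro adj[OF _ x]) (auto simp: dvd_add_left_iff dvd_add_right_iff)
  qed
qed

text \<open>If r = p, cancelling p^j leaves a factor p; otherwise r^j is coprime to p. It is applied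
  to matrix entries between different labels.\<close>

lemma prime_dvd_of_power_dvd_mult:
  fixes c :: int
  assumes "prime p" "p ^ k dvd r ^ j * c" "prime r" "k \<ge> 1" "r = p \<Longrightarrow> j < k"
  shows "p dvd c"
proof (cases "r = p")
  case True
  then have "p ^ j * p dvd p ^ k" using assms(5) by (metis Suc_leI le_imp_power_dvd power_Suc2)
  then have "p ^ j * p dvd p ^ j * c" using assms(2) True dvd_trans by blast
  then show ?thesis using assms(1) by auto
next
  case False
  then have "coprime p (r ^ j)" using assms(1,3) primes_coprime by (auto intro!: coprime_power_right_iff[THEN iffD2])
  moreover have "p dvd r ^ j * c" using assms(2,4) dvd_trans[OF dvd_power[of k p]] by simp
  ultimately show ?thesis using coprime_dvd_mult_right_iff by blast
qed

text \<open>The full matrices of h' and h multiply to the identity modulo the label, hence modulo p.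
  Modulo p, only vertices t with label p^k contribute to the entries considered.\<close>

lemma coord_block_inverse_mod:
  assumes fin: "finite V1" "finite V2" and prim: "primary_labels V2 n2"
    and h: "h \<in> hom (graph_product V1 E1 n1) (graph_product V2 E2 n2)"
    and h': "h' \<in> hom (graph_product V2 E2 n2) (graph_product V1 E1 n1)"
    and inv: "\<And>g. g \<in> carrier (graph_product V1 E1 n1) \<Longrightarrow> h' (h g) = g"
    and p: "prime p" "k \<ge> 1"
    and u: "u \<in> V1" "v \<in> V1" "n1 u = p ^ k" "n1 v = p ^ k"
  shows "[(\<Sum>t\<in>{t \<in> V2. n2 t = p ^ k}.
        coord u (h' (gen V2 E2 n2 t)) * coord t (h (gen V1 E1 n1 v)))
      = (if u = v then 1 else 0)] (mod int p)"
proof -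
  let ?B = "\<lambda>t. coord u (h' (gen V2 E2 n2 t))" and ?A = "\<lambda>t. coord t (h (gen V1 E1 n1 v))"
  have "h (gen V1 E1 n1 v) \<in> carrier (graph_product V2 E2 n2)"
    using h u by (auto simp: hom_def)
  from coord_hom_gen[OF fin(2) h' this, of u]
  have "[coord u (gen V1 E1 n1 v) = (\<Sum>t\<in>V2. ?A t * ?B t)] (mod int (n1 u))"
    using u inv by simp
  then have "[(\<Sum>t\<in>V2. ?A t * ?B t) = (if u = v then 1 else 0)] (mod int (n1 u))"
    using cong_trans[OF cong_sym coord_gen[OF u(2), of u E1 n1]] by (simp add: eq_commute)
  moreover have "int p dvd int (n1 u)" using u p by simp
  ultimately have all: "[(\<Sum>t\<in>V2. ?A t * ?B t) = (if u = v then 1 else 0)] (mod int p)"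
    by (rule cong_dvd_modulus)
  have off: "int p dvd ?A t * ?B t" if t: "t \<in> V2" "n2 t \<noteq> p ^ k" for t
  proof -
    obtain r j where r: "prime r" "j \<ge> 1" "n2 t = r ^ j"
      using prim t by (auto simp: primary_labels_def)
    have B: "int p ^ k dvd int r ^ j * ?B t"
      using label_mult_coord_hom[OF fin(2) h' t(1), of u] u r by simp
    have A: "int r ^ j dvd int p ^ k * ?A t"
      using label_mult_coord_hom[OF fin(1) h u(2), of t] u r by simp
    have ne: "int p ^ k \<noteq> int r ^ j" using t(2) r(3) by (metis of_nat_eq_iff of_nat_power)
    show ?thesis
    \<comment> \<open>A homomorphism from a cyclic group of order p^k to one of larger order p^j has
      image in the multiples of p, which settles the entry of h. In the remaining cases the same
      kind of argument applies to the entry of h'.\<close>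
    proof (cases "r = p \<and> k < j")
      case True
      have "int r dvd ?A t"
        using prime_dvd_of_power_dvd_mult[OF _ A] r p ne True by simp
      then show ?thesis using True by simp
    next
      case False
      have "int p dvd ?B t"
        using prime_dvd_of_power_dvd_mult[OF _ B] r p ne False by (cases j k rule: linorder_cases) auto
      then show ?thesis by simp
    qed
  qed
  have "[(\<Sum>t\<in>V2. ?A t * ?B t) = (\<Sum>t\<in>V2. if n2 t = p ^ k then ?B t * ?A t else 0)] (mod int p)"
    using off by (intro cong_sum) (auto simp: mult.commute cong_0_iff)
  then show ?thesis
    using cong_trans[OF cong_sym all] fin(2) by (simp add: sum.inter_filter)
qed

lemma label_preserving_injection:
  assumes lg: "labeled_graph V1 E1 n1" "labeled_graph V2 E2 n2"
    and prim: "primary_labels V1 n1" "primary_labels V2 n2"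
    and \<tau>: "\<tau> \<in> iso (graph_product V1 E1 n1) (graph_product V2 E2 n2)"
  obtains f where "inj_on f V1" "f ` V1 \<subseteq> V2" "\<And>u. u \<in> V1 \<Longrightarrow> n2 (f u) = n1 u"
    "\<And>u. u \<in> V1 \<Longrightarrow> \<not> int (n2 (f u)) dvd coord (f u) (\<tau> (gen V1 E1 n1 u))"
proof -
  let ?G1 = "graph_product V1 E1 n1" and ?G2 = "graph_product V2 E2 n2"
  interpret G1: group ?G1 by (rule group_graph_product)
  define \<tau>' where "\<tau>' = inv_into (carrier ?G1) \<tau>"
  have hom: "\<tau> \<in> hom ?G1 ?G2" and bij: "bij_betw \<tau> (carrier ?G1) (carrier ?G2)"
    using \<tau> by (auto simp: iso_def)
  have hom': "\<tau>' \<in> hom ?G2 ?G1"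
    using G1.iso_set_sym[OF \<tau>] by (auto simp: iso_def \<tau>'_def)
  have l: "\<tau>' (\<tau> g) = g" if "g \<in> carrier ?G1" for g
    using bij_betw_inv_into_left[OF bij that] by (simp add: \<tau>'_def)
  have r: "\<tau> (\<tau>' g) = g" if "g \<in> carrier ?G2" for g
    using bij_betw_inv_into_right[OF bij that] by (simp add: \<tau>'_def)
  have fin: "finite V1" "finite V2" using lg by (auto simp: labeled_graph_def)
  define U T where "U q = {u \<in> V1. n1 u = q}" and "T q = {t \<in> V2. n2 t = q}" for q
  let ?A = "\<lambda>t u. coord t (\<tau> (gen V1 E1 n1 u))" and ?B = "\<lambda>u t. coord u (\<tau>' (gen V2 E2 n2 t))"
  have "\<exists>f. inj_on f (U q) \<and> f ` U q \<subseteq> T q \<and> (\<forall>u \<in> U q. \<not> int q dvd ?A (f u) u)"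
    if q: "q \<in> n1 ` V1" for q
  proof -
    obtain p k where pk: "prime p" "k \<ge> 1" "q = p ^ k"
      using prim(1) q by (auto simp: primary_labels_def)
    have p1: "\<not> int p dvd 1" using pk(1) by (simp add: prime_nat_iff)
    have BA: "[(\<Sum>t\<in>T q. ?B u t * ?A t v) = (if u = v then 1 else 0)] (mod int p)"
      if "u \<in> U q" "v \<in> U q" for u v
      using coord_block_inverse_mod[OF fin prim(2) hom hom' l pk(1,2), of u v] that pk(3)
      by (simp add: U_def T_def)
    have AB: "[(\<Sum>u\<in>U q. ?A s u * ?B u t) = (if s = t then 1 else 0)] (mod int p)"
      if "s \<in> T q" "t \<in> T q" for s t
      using coord_block_inverse_mod[OF fin(2,1) prim(1) hom' hom r pk(1,2), of s t] that pk(3)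
      by (simp add: U_def T_def)
    have finUT: "finite (U q)" "finite (T q)" using fin by (auto simp: U_def T_def)
    \<comment> \<open>Otherwise the matching lemma, with the two matrices exchanged, would inject
      the larger set into the smaller one.\<close>
    have "card (T q) \<le> card (U q)"
    proof (rule ccontr)
      assume "\<not> card (T q) \<le> card (U q)"
      then obtain g where "inj_on g (T q)" "g ` T q \<subseteq> U q"
        using matching_of_left_inverse_mod[OF finUT(2,1) _ p1 AB] by (metis nle_le)
      then show False using \<open>\<not> card (T q) \<le> card (U q)\<close> card_inj_on_le finUT(1) by blast
    qed
    then obtain f where f: "inj_on f (U q)" "f ` U q \<subseteq> T q" "\<And>u. u \<in> U q \<Longrightarrow> \<not> int p dvd ?A (f u) u"
      using matching_of_left_inverse_mod[OF finUT _ p1 BA] by metis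
    moreover have "int p dvd int q" using pk by simp
    ultimately show ?thesis using dvd_trans by blast
  qed
  then obtain F where F: "\<And>q. q \<in> n1 ` V1 \<Longrightarrow> inj_on (F q) (U q) \<and> F q ` U q \<subseteq> T q
      \<and> (\<forall>u \<in> U q. \<not> int q dvd ?A (F q u) u)" by metis
  \<comment> \<open>The matchings of the blocks are glued together. Labels are preserved, so
    vertices of different blocks have different images.\<close>
  define f where "f u = F (n1 u) u" for u
  have f: "f u \<in> V2" "n2 (f u) = n1 u" "\<not> int (n1 u) dvd ?A (f u) u" if "u \<in> V1" for u
    using F[of "n1 u"] that by (auto simp: f_def U_def T_def)
  have "inj_on f V1"
  proof (rule inj_onI)
    fix u v assume uv: "u \<in> V1" "v \<in> V1" "f u = f v"
    then have "n1 u = n1 v" using f(2) by metis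
    then show "u = v" using F[of "n1 u"] uv by (auto simp: f_def U_def inj_on_def)
  qed
  then show ?thesis using that f by (metis image_subsetI)
qed

theorem theorem4p4:
  fixes V1 :: "'a set" and E1 :: "'a \<Rightarrow> 'a \<Rightarrow> bool" and n1 :: "'a \<Rightarrow> nat"
    and V2 :: "'b set" and E2 :: "'b \<Rightarrow> 'b \<Rightarrow> bool" and n2 :: "'b \<Rightarrow> nat"
    and \<tau> :: "('a \<times> bool) list set \<Rightarrow> ('b \<times> bool) list set"
  assumes "labeled_graph V1 E1 n1" and "labeled_graph V2 E2 n2"
    and "primary_labels V1 n1" and "primary_labels V2 n2"
    and "\<tau> \<in> iso (graph_product V1 E1 n1) (graph_product V2 E2 n2)"
  shows "\<exists>t. labeled_graph_iso V1 E1 n1 V2 E2 n2 t \<and>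
           (\<forall>u\<in>V1. t u \<in> csupp V2 E2 n2 (\<tau> (gen V1 E1 n1 u)))"
proof -
  let ?G1 = "graph_product V1 E1 n1" and ?G2 = "graph_product V2 E2 n2"
  define \<tau>' where "\<tau>' = inv_into (carrier ?G1) \<tau>"
  have \<tau>': "\<tau>' \<in> iso ?G2 ?G1"
    using group.iso_set_sym[OF group_graph_product assms(5)] by (simp add: \<tau>'_def)
  have fin: "finite V1" "finite V2"
    and E1V: "\<And>u v. E1 u v \<Longrightarrow> u \<in> V1 \<and> v \<in> V1 \<and> u \<noteq> v"
    and E2V: "\<And>u v. E2 u v \<Longrightarrow> u \<in> V2 \<and> v \<in> V2 \<and> u \<noteq> v"
    using assms(1,2) by (auto simp: labeled_graph_def)
  obtain t where t: "inj_on t V1" "t ` V1 \<subseteq> V2" "\<And>u. u \<in> V1 \<Longrightarrow> n2 (t u) = n1 u"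
    "\<And>u. u \<in> V1 \<Longrightarrow> \<not> int (n2 (t u)) dvd coord (t u) (\<tau> (gen V1 E1 n1 u))"
    by (rule label_preserving_injection[OF assms], rule that)
  obtain s where s: "inj_on s V2" "s ` V2 \<subseteq> V1" "\<And>u. u \<in> V2 \<Longrightarrow> n1 (s u) = n2 u"
    "\<And>u. u \<in> V2 \<Longrightarrow> \<not> int (n1 (s u)) dvd coord (s u) (\<tau>' (gen V2 E2 n2 u))"
    by (rule label_preserving_injection[OF assms(2,1,4,3) \<tau>'], rule that)
  \<comment> \<open>\<open>t u\<close> and \<open>t v\<close> are distinct by injectivity and lie in
    the supports of the abelianized images of the adjacent generators u and v.\<close>
  have tE: "E2 (t u) (t v)" if "E1 u v" for u v
    using coord_hom_supports_adjacent[OF assms(1,2) _ that, of \<tau> "t u" "t v"] E1V[OF that] t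
      assms(5) by (auto simp: iso_def inj_on_eq_iff)
  have sE: "E1 (s u) (s v)" if "E2 u v" for u v
    using coord_hom_supports_adjacent[OF assms(2,1) _ that, of \<tau>' "s u" "s v"] E2V[OF that] s
      \<tau>' by (auto simp: iso_def inj_on_eq_iff)
  have "card V1 = card V2"
    using card_inj_on_le[OF t(1,2) fin(2)] card_inj_on_le[OF s(1,2) fin(1)] by simp
  then have bij: "bij_betw t V1 V2"
    using t(1,2) fin by (simp add: bij_betw_def card_image card_subset_eq)
  \<comment> \<open>Both t and s map edges injectively to edges, so the two graphs have equally many edges and
    t hits every edge.\<close>
  define R1 R2 where "R1 = {(u, v). E1 u v}" and "R2 = {(u, v). E2 u v}"
  have "R1 \<subseteq> V1 \<times> V1" "R2 \<subseteq> V2 \<times> V2" using E1V E2V by (auto simp: R1_def R2_def)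
  then have finR: "finite R1" "finite R2" using fin by (meson finite_SigmaI finite_subset)+
  have injR: "inj_on (map_prod t t) R1" "inj_on (map_prod s s) R2"
    using map_prod_inj_on[OF t(1) t(1)] map_prod_inj_on[OF s(1) s(1)] \<open>R1 \<subseteq> _\<close> \<open>R2 \<subseteq> _\<close>
    by (auto intro: inj_on_subset)
  have subR: "map_prod t t ` R1 \<subseteq> R2" "map_prod s s ` R2 \<subseteq> R1"
    using tE sE by (auto simp: R1_def R2_def)
  have "card R1 = card R2"
    using card_inj_on_le[OF injR(1) subR(1) finR(2)] card_inj_on_le[OF injR(2) subR(2) finR(1)] by simp
  then have surjR: "map_prod t t ` R1 = R2"
    using injR(1) subR(1) finR by (simp add: card_image card_subset_eq)
  have "E1 u v" if "E2 (t u) (t v)" "u \<in> V1" "v \<in> V1" for u v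
  proof -
    \<comment> \<open>The edge has a preimage under t, and injectivity identifies its endpoints with
      u and v.\<close>
    have "(t u, t v) \<in> map_prod t t ` R1" using that(1) surjR by (simp add: R2_def)
    then obtain x y where "E1 x y" "t x = t u" "t y = t v" by (auto simp: R1_def)
    then show ?thesis using E1V t(1) that(2,3) by (metis inj_onD)
  qed
  then have "labeled_graph_iso V1 E1 n1 V2 E2 n2 t"
    using bij tE t(3) by (auto simp: labeled_graph_iso_def)
  moreover have "t u \<in> csupp V2 E2 n2 (\<tau> (gen V1 E1 n1 u))" if "u \<in> V1" for u
    using assms(5) t(2,4) that by (intro coord_imp_mem_csupp) (auto simp: iso_def hom_def)
  ultimately show ?thesis by blast
qed

end
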